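(* Let $\lambda_0=(1,0,\dots,0)$ be the highest weight of the vector representation $\pi_0$ of $\mathfrak{gl}_n(\mathbb{C})$, and let $\lambda=(\lambda_1\ge\lambda_2\ge\dots\ge\lambda_n\ge 0)$ be a partition. Let $\check{\pi}_0$ and $\check{\pi}_\lambda$ be the representations of the Yangian $Y(n)$ obtained from the $\mathfrak{gl}_n(\mathbb{C})$-representations $\pi_0$ and $\pi_\lambda$ by means of the map $\check{\mathrm{ev}}:Y(n)\to U(\mathfrak{gl}_n(\mathbb{C}))$. Let $\mathcal{R}(u)$ be the universal R-matrix. Then $$(\check{\pi}_0\otimes\check{\pi}_\lambda)\,\mathcal{R}(u)=f(u)\left(1-\frac{\Omega_\lambda}{u}\right),$$ where $f(u)$ is some complex-valued rational function of $u$ (which depends on $\lambda$), and $\Omega_\lambda$ is regarded as the element $\sum_{i,j}E_{ij}\otimes\pi_\lambda(E_{ji})$ of $\mathrm{End}(\mathbb{C}^n)\otimes\mathrm{End}(V_\lambda)$.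
   Context: $E_{ij}$ are the standard matrix units of $\mathfrak{gl}_n(\mathbb{C})$; $\pi_\lambda$ is the irreducible representation of $\mathfrak{gl}_n(\mathbb{C})$ with highest weight $\lambda$, on the space $V_\lambda$; $\pi_0=\pi_{\lambda_0}$ acts on $\mathbb{C}^n$. The braided Casimir element is $\Omega_\lambda=\sum_{i,j=1}^nE_{ij}\otimes\pi_\lambda(E_{ji})$; here its first tensor factor is taken in $\mathrm{End}(\mathbb{C}^n)$. The Yangian $Y(n)$ of $\mathfrak{gl}_n(\mathbb{C})$ is the unital associative algebra over $\mathbb{C}$ with generators $t_{ij}^{(r)}$ ($r\ge1$, $1\le i,j\le n$) and the relations $R(u-v)T_1(u)T_2(v)=T_2(v)T_1(u)R(u-v)$, where $T(u)=(t_{ij}(u))_{i,j=1}^n$, $t_{ij}(u)=\delta_{ij}+\sum_{k\ge1}t_{ij}^{(k)}u^{-k}$, $R(u)=1-P/u$ is the Yang matrix, $P=\sum_{i,j} E_{ij}\otimes E_{ji}$ is the permutation operator on $\mathbb{C}^n\otimes\mathbb{C}^n$, and $T_k(u)=\sum_{i,j} t_{ij}(u)\otimes(E_{ij})_k$, with $(E_{ij})_k$ acting as $E_{ij}$ in the $k$-th copy of $\mathbb{C}^n$. The algebra homomorphism $\check{\mathrm{ev}}:Y(n)\to U(\mathfrak{gl}_n(\mathbb{C}))$ is defined by $\check{\mathrm{ev}}(t_{ij}(u))=\delta_{ij}-E_{ji}/u$. For a $\mathfrak{gl}_n(\mathbb{C})$-representation $\pi$, the $Y(n)$-representation $\check\pi$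 is $\check\pi=\pi\circ\check{\mathrm{ev}}$. $\mathcal{R}(u)$ is the universal R-matrix (in the sense of Drinfeld) of the Yangian of $\mathfrak{sl}_n(\mathbb{C})$, regarded as a formal power series in $u^{-1}$ with coefficients in $Y(n)\otimes Y(n)$. It satisfies the quantum Yang–Baxter equation $\mathcal{R}^{12}(u-v)\mathcal{R}^{13}(u-w)\mathcal{R}^{23}(v-w)=\mathcal{R}^{23}(v-w)\mathcal{R}^{13}(u-w)\mathcal{R}^{12}(u-v)$ and $(\mathrm{id}\otimes\Delta)(\mathcal{R}(u))=\mathcal{R}_{12}(u)\mathcal{R}_{13}(u)$, where $\Delta$ is the coproduct of $Y(n)$. The conventions used for it are: $R(u)=f_0(u)\,(\check\pi_0\otimes\check\pi_0)\mathcal{R}(u)$ for some complex-valued rational function $f_0(u)$, and $T(u)=(\check\pi_0\otimes\mathrm{id})\mathcal{R}(u)$. *)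

theory Defs
  imports
    "HOL-Analysis.Analysis"
    "HOL-Computational_Algebra.Computational_Algebra"
    "HOL-Library.Poly_Mapping"
begin

no_notation fps_nth (infixl \<open>$\<close> 75)

section \<open>Complex vector spaces and associative unital algebras\<close>

class scaleC =
  fixes scaleC :: "complex \<Rightarrow> 'a \<Rightarrow> 'a" (infixr \<open>*\<^sub>C\<close> 75)

class complex_vector = scaleC + ab_group_add +
  assumes scaleC_add_right: "a *\<^sub>C (x + y) = a *\<^sub>C x + a *\<^sub>C y"
    and scaleC_add_left: "(a + b) *\<^sub>C x = a *\<^sub>C x + b *\<^sub>C x"
    and scaleC_scaleC: "a *\<^sub>C (b *\<^sub>C x) = (a * b) *\<^sub>C x"
    and scaleC_one: "1 *\<^sub>C x = x"

interpretation complex_vector: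
  vector_space "scaleC :: complex \<Rightarrow> 'a \<Rightarrow> 'a::complex_vector"
  by standard (simp_all add: scaleC_add_right scaleC_add_left scaleC_scaleC scaleC_one)

text \<open>The zero algebra is not excluded, so that endomorphism algebras and quotient algebras
  are instances unconditionally.\<close>

class complex_algebra_1 = complex_vector + ring + monoid_mult +
  assumes scaleC_mult_left: "(a *\<^sub>C x) * y = a *\<^sub>C (x * y)"
    and scaleC_mult_right: "x * (a *\<^sub>C y) = a *\<^sub>C (x * y)"

definition alg_hom :: "('a::complex_algebra_1 \<Rightarrow> 'b::complex_algebra_1) \<Rightarrow> bool" where
  "alg_hom h \<longleftrightarrow> Vector_Spaces.linear scaleC scaleC h \<and> (\<forall>x y. h (x * y) = h x * h y) \<and> h 1 = 1"

instantiation complex :: complex_vector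
begin
definition scaleC_complex :: "complex \<Rightarrow> complex \<Rightarrow> complex" where "scaleC_complex = (*)"
instance by standard (simp_all add: scaleC_complex_def algebra_simps)
end

instantiation vec :: (complex_vector, finite) complex_vector
begin
definition scaleC_vec :: "complex \<Rightarrow> 'a^'b \<Rightarrow> 'a^'b" where "c *\<^sub>C x = (\<chi> i. c *\<^sub>C x $ i)"
instance
  by standard (simp_all add: scaleC_vec_def vec_eq_iff scaleC_add_right scaleC_add_left
      scaleC_scaleC scaleC_one)
end

lemma clinear_iff:
  "Vector_Spaces.linear scaleC scaleC f \<longleftrightarrow>
    (\<forall>x y. f (x + y) = f x + f y) \<and> (\<forall>c x. f (c *\<^sub>C x) = c *\<^sub>C f x)"
  for f :: "'a::complex_vector \<Rightarrow> 'b::complex_vector"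
  by (auto simp: Vector_Spaces.linear_def module_hom_def module_hom_axioms_def
      complex_vector.vector_space_axioms complex_vector.module_axioms)

typedef (overloaded) 'v endo =
  "{f :: 'v::complex_vector \<Rightarrow> 'v. Vector_Spaces.linear scaleC scaleC f}"
  morphisms endo_apply Abs_endo
  by (rule exI[of _ "\<lambda>x. x"]) (simp add: clinear_iff)

setup_lifting type_definition_endo

instantiation endo :: (complex_vector) complex_algebra_1
begin
lift_definition zero_endo :: "'a endo" is "\<lambda>_. 0" by (simp add: clinear_iff)
lift_definition one_endo :: "'a endo" is "\<lambda>x. x" by (simp add: clinear_iff)
lift_definition plus_endo :: "'a endo \<Rightarrow> 'a endo \<Rightarrow> 'a endo" is "\<lambda>f g x. f x + g x"
  by (simp add: clinear_iff scaleC_add_right)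
lift_definition minus_endo :: "'a endo \<Rightarrow> 'a endo \<Rightarrow> 'a endo" is "\<lambda>f g x. f x - g x"
  by (simp add: clinear_iff complex_vector.scale_right_diff_distrib)
lift_definition uminus_endo :: "'a endo \<Rightarrow> 'a endo" is "\<lambda>f x. - f x"
  by (simp add: clinear_iff)
lift_definition times_endo :: "'a endo \<Rightarrow> 'a endo \<Rightarrow> 'a endo" is "\<lambda>f g x. f (g x)"
  by (simp add: clinear_iff)
lift_definition scaleC_endo :: "complex \<Rightarrow> 'a endo \<Rightarrow> 'a endo" is "\<lambda>c f x. c *\<^sub>C f x"
  by (simp add: clinear_iff scaleC_add_right scaleC_scaleC mult.commute)
instance
  by standard (transfer; simp add: clinear_iff fun_eq_iff algebra_simps scaleC_add_right
      scaleC_add_left scaleC_scaleC scaleC_one)+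
end

section \<open>Algebras given by generators and relations\<close>

datatype 'x word = Word (letters: "'x list")

instantiation word :: (type) monoid_add
begin
definition zero_word :: "'a word" where "0 = Word []"
definition plus_word :: "'a word \<Rightarrow> 'a word \<Rightarrow> 'a word" where
  "v + w = Word (letters v @ letters w)"
instance by standard (simp_all add: zero_word_def plus_word_def)
end

text \<open>The monoid algebra of the free monoid on \<^typ>\<open>'x\<close> is the free algebra on \<^typ>\<open>'x\<close>.\<close>

type_synonym 'x free_alg = "'x word \<Rightarrow>\<^sub>0 complex"

definition free_gen :: "'x \<Rightarrow> 'x free_alg" where
  "free_gen x = Poly_Mapping.single (Word [x]) 1"

definition free_const :: "complex \<Rightarrow> 'x free_alg" where
  "free_const c = Poly_Mapping.single 0 c"

definition free_eval :: "('x \<Rightarrow> 'a::complex_algebra_1) \<Rightarrow> 'x free_alg \<Rightarrow> 'a" where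
  "free_eval g p =
    (\<Sum>w\<in>Poly_Mapping.keys p. Poly_Mapping.lookup p w *\<^sub>C prod_list (map g (letters w)))"

inductive_set two_sided_ideal :: "'a::ring_1 set \<Rightarrow> 'a set" for S where
  zero: "0 \<in> two_sided_ideal S"
| step: "r \<in> S \<Longrightarrow> x \<in> two_sided_ideal S \<Longrightarrow> a * r * b + x \<in> two_sided_ideal S"

text \<open>A type of generators carries its defining relators; \<open>'x presented\<close> is the algebra
  generated by the elements of \<open>'x\<close> subject to \<open>r = 0\<close> for every relator \<open>r\<close>.\<close>

class presentation =
  fixes relators :: "('a word \<Rightarrow>\<^sub>0 complex) set"

lemma two_sided_ideal_add:
  "x \<in> two_sided_ideal S \<Longrightarrow> y \<in> two_sided_ideal S \<Longrightarrow> x + y \<in> two_sided_ideal S"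
  by (induction rule: two_sided_ideal.induct)
    (auto simp: add.assoc intro: two_sided_ideal.intros)

lemma two_sided_ideal_mult:
  "x \<in> two_sided_ideal S \<Longrightarrow> c * x * d \<in> two_sided_ideal S"
proof (induction rule: two_sided_ideal.induct)
  case (step r x a b)
  have "c * (a * r * b + x) * d = (c * a) * r * (b * d) + c * x * d"
    by (simp add: algebra_simps)
  then show ?case using step by (auto intro: two_sided_ideal.step)
qed (simp add: two_sided_ideal.zero)

lemma two_sided_ideal_mult_left: "x \<in> two_sided_ideal S \<Longrightarrow> c * x \<in> two_sided_ideal S"
  using two_sided_ideal_mult[of x S c 1] by simp

lemma two_sided_ideal_mult_right: "x \<in> two_sided_ideal S \<Longrightarrow> x * d \<in> two_sided_ideal S"
  using two_sided_ideal_mult[of x S 1 d] by simp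

lemma two_sided_ideal_uminus: "x \<in> two_sided_ideal S \<Longrightarrow> - x \<in> two_sided_ideal S"
  using two_sided_ideal_mult_left[of x S "- 1"] by simp

lemma free_const_add: "free_const (a + b) = free_const a + free_const b"
  by (simp add: free_const_def single_add)

lemma free_const_mult: "free_const (a * b) = free_const a * free_const b"
  by (simp add: free_const_def mult_single)

lemma free_const_one: "free_const 1 = 1"
  by (simp add: free_const_def single_one)

lemma free_alg_expand:
  "p = (\<Sum>w\<in>Poly_Mapping.keys p. Poly_Mapping.single w (Poly_Mapping.lookup p w))"
  for p :: "'x free_alg"
  by (rule poly_mapping_eqI) (simp add: lookup_sum lookup_single when_def in_keys_iff)

lemma free_const_central: "p * free_const c = free_const c * p"
  by (subst (1 2) free_alg_expand[of p])
    (simp add: free_const_def sum_distrib_left sum_distrib_right mult_single mult.commute)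

quotient_type (overloaded) 'x presented = "'x::presentation free_alg" /
  "\<lambda>p q. p - q \<in> two_sided_ideal relators"
proof (rule equivpI)
  show "reflp (\<lambda>p q :: 'x free_alg. p - q \<in> two_sided_ideal relators)"
    by (simp add: reflp_def two_sided_ideal.zero)
  show "symp (\<lambda>p q :: 'x free_alg. p - q \<in> two_sided_ideal relators)"
    unfolding symp_def using two_sided_ideal_uminus by fastforce
  show "transp (\<lambda>p q :: 'x free_alg. p - q \<in> two_sided_ideal relators)"
    unfolding transp_def using two_sided_ideal_add by fastforce
qed

instantiation presented :: (presentation) complex_algebra_1
begin
lift_definition zero_presented :: "'a presented" is 0 .
lift_definition one_presented :: "'a presented" is 1 .
lift_definition plus_presented :: "'a presented \<Rightarrow> 'a presented \<Rightarrow> 'a presented" is "(+)"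
  using two_sided_ideal_add by (fastforce simp: add_diff_add)
lift_definition uminus_presented :: "'a presented \<Rightarrow> 'a presented" is uminus
  using two_sided_ideal_uminus by fastforce
lift_definition minus_presented :: "'a presented \<Rightarrow> 'a presented \<Rightarrow> 'a presented" is "(-)"
proof -
  fix p q r s :: "'a free_alg"
  assume "p - q \<in> two_sided_ideal relators" "r - s \<in> two_sided_ideal relators"
  then have "(p - q) + - (r - s) \<in> two_sided_ideal relators"
    by (intro two_sided_ideal_add two_sided_ideal_uminus)
  then show "p - r - (q - s) \<in> two_sided_ideal relators" by (simp add: algebra_simps)
qed
lift_definition times_presented :: "'a presented \<Rightarrow> 'a presented \<Rightarrow> 'a presented" is "(*)"
proof -
  fix p q r s :: "'a free_alg"
  assume "p - q \<in> two_sided_ideal relators" "r - s \<in> two_sided_ideal relators"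
  then have "(p - q) * r + q * (r - s) \<in> two_sided_ideal relators"
    by (intro two_sided_ideal_add two_sided_ideal_mult_left two_sided_ideal_mult_right)
  then show "p * r - q * s \<in> two_sided_ideal relators" by (simp add: algebra_simps)
qed
lift_definition scaleC_presented :: "complex \<Rightarrow> 'a presented \<Rightarrow> 'a presented" is
  "\<lambda>c p. free_const c * p"
  by (simp add: two_sided_ideal_mult_left flip: right_diff_distrib)

instance
proof
  fix p q r :: "'a presented" and a b :: complex
  show "p + q + r = p + (q + r)" "p + q = q + p" "0 + p = p" "- p + p = 0" "p - q = p + - q"
    "p * q * r = p * (q * r)" "(p + q) * r = p * r + q * r" "p * (q + r) = p * q + p * r"
    "1 * p = p" "p * 1 = p"
    by (transfer; simp add: algebra_simps two_sided_ideal.zero)+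
  show "a *\<^sub>C (p + q) = a *\<^sub>C p + a *\<^sub>C q"
    by (transfer; simp add: algebra_simps two_sided_ideal.zero)
  show "(a + b) *\<^sub>C p = a *\<^sub>C p + b *\<^sub>C p"
    by (transfer; simp add: free_const_add algebra_simps two_sided_ideal.zero)
  show "a *\<^sub>C b *\<^sub>C p = (a * b) *\<^sub>C p"
    by (transfer; simp add: free_const_mult algebra_simps two_sided_ideal.zero)
  show "1 *\<^sub>C p = p"
    by (transfer; simp add: free_const_one two_sided_ideal.zero)
  show "a *\<^sub>C p * q = a *\<^sub>C (p * q)"
    by (transfer; simp add: mult.assoc two_sided_ideal.zero)
  show "p * a *\<^sub>C q = a *\<^sub>C (p * q)"
    by (transfer; simp add: free_const_central two_sided_ideal.zero flip: mult.assoc)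
qed
end

lift_definition gen :: "'x \<Rightarrow> 'x::presentation presented" is free_gen .

text \<open>The algebra homomorphism extending a map on generators, provided that map respects
  the relators (see \<open>extend_hom\<close>).\<close>

definition extend :: "('x::presentation \<Rightarrow> 'a::complex_algebra_1) \<Rightarrow> 'x presented \<Rightarrow> 'a" where
  "extend g x = free_eval g (rep_presented x)"

lemma free_eval_superset:
  assumes "finite A" "Poly_Mapping.keys p \<subseteq> A"
  shows "free_eval g p =
    (\<Sum>w\<in>A. Poly_Mapping.lookup p w *\<^sub>C prod_list (map g (letters w)))"
  unfolding free_eval_def using assms
  by (intro sum.mono_neutral_left) (auto simp: in_keys_iff)

lemma free_eval_add: "free_eval g (p + q) = free_eval g p + free_eval g q"
proof -
  let ?A = "Poly_Mapping.keys p \<union> Poly_Mapping.keys q"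
  have "Poly_Mapping.keys (p + q) \<subseteq> ?A" by (rule keys_add)
  then show ?thesis
    by (simp add: free_eval_superset[of ?A] lookup_add scaleC_add_left sum.distrib)
qed

lemma free_eval_zero: "free_eval g 0 = 0"
  by (simp add: free_eval_def)

lemma free_eval_single:
  "free_eval g (Poly_Mapping.single w c) = c *\<^sub>C prod_list (map g (letters w))"
  by (simp add: free_eval_superset[of "{w}"])

lemma free_eval_sum: "free_eval g (sum f A) = (\<Sum>x\<in>A. free_eval g (f x))"
  by (induction A rule: infinite_finite_induct) (simp_all add: free_eval_zero free_eval_add)

lemma free_eval_uminus: "free_eval g (- p) = - free_eval g p"
  using free_eval_add[of g p "- p"] by (simp add: free_eval_zero eq_neg_iff_add_eq_0 add.commute)

lemma free_eval_diff: "free_eval g (p - q) = free_eval g p - free_eval g q"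
  using free_eval_add[of g p "- q"] by (simp add: free_eval_uminus)

lemma free_eval_mult: "free_eval g (p * q) = free_eval g p * free_eval g q"
proof -
  let ?s = "\<lambda>p. \<Sum>w\<in>Poly_Mapping.keys p. Poly_Mapping.single w (Poly_Mapping.lookup p w)"
  have "free_eval g (p * q) = free_eval g (?s p * ?s q)"
    by (simp only: free_alg_expand[symmetric])
  also have "\<dots> = free_eval g p * free_eval g q"
    unfolding free_eval_def[of g p] free_eval_def[of g q]
    by (simp add: sum_product mult_single free_eval_sum free_eval_single plus_word_def
        scaleC_mult_left scaleC_mult_right scaleC_scaleC mult.commute)
  finally show ?thesis .
qed

lemma free_eval_gen: "free_eval g (free_gen x) = g x"
  by (simp add: free_gen_def free_eval_single scaleC_one)

lemma free_eval_const: "free_eval g (free_const c) = c *\<^sub>C 1"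
  by (simp add: free_const_def free_eval_single zero_word_def)

lemma free_eval_one: "free_eval g 1 = 1"
  using free_eval_const[of g 1] by (simp add: free_const_one scaleC_one)

theorem extend_hom:
  assumes "\<And>r. r \<in> relators \<Longrightarrow> free_eval g r = 0"
  shows "alg_hom (extend g)" and "extend g (gen x) = g x"
proof -
  have ideal: "free_eval g p = 0" if "p \<in> two_sided_ideal relators" for p
    using that by induction
      (simp_all add: free_eval_zero free_eval_add free_eval_mult assms)
  have abs: "extend g (abs_presented p) = free_eval g p" for p
  proof -
    have "rep_presented (abs_presented p) - p \<in> two_sided_ideal relators"
      using Quotient3_abs_rep[OF Quotient3_presented, of "abs_presented p"]
      by (simp add: presented.abs_eq_iff)
    then show ?thesis
      using ideal[of "rep_presented (abs_presented p) - p"]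
      by (simp add: extend_def free_eval_diff)
  qed
  have ex: "\<exists>p. y = abs_presented p" for y :: "'a presented"
    using Quotient3_abs_rep[OF Quotient3_presented, of y] by metis
  show "extend g (gen x) = g x"
    by (simp add: gen.abs_eq abs free_eval_gen)
  show "alg_hom (extend g)"
    unfolding alg_hom_def clinear_iff
  proof (intro conjI allI)
    fix y z :: "'a presented" and c
    obtain p q where "y = abs_presented p" "z = abs_presented q" using ex by metis
    then show "extend g (y + z) = extend g y + extend g z"
      "extend g (c *\<^sub>C y) = c *\<^sub>C extend g y" "extend g (y * z) = extend g y * extend g z"
      by (simp_all add: plus_presented.abs_eq scaleC_presented.abs_eq times_presented.abs_eq
          abs free_eval_add free_eval_mult free_eval_const scaleC_mult_left)
  qed (simp add: one_presented.abs_eq abs free_eval_one)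
qed

section \<open>Tensor products\<close>

text \<open>\<open>A \<otimes> B\<close> is generated by the symbols \<open>x \<otimes> y\<close> subject to bilinearity and to
  \<open>(x \<otimes> y) (x' \<otimes> y') = x x' \<otimes> y y'\<close>, \<open>1 \<otimes> 1 = 1\<close>. The multiplicative relators make every element
  a linear combination of symbols, so this is the vector space tensor product with its usual
  multiplication.\<close>

datatype ('a, 'b) tensor_symbol = Tensor 'a 'b

instantiation tensor_symbol :: (complex_algebra_1, complex_algebra_1) presentation
begin
definition relators_tensor_symbol :: "('a, 'b) tensor_symbol free_alg set" where
  "relators_tensor_symbol =
    {free_gen (Tensor (x + x') y) - free_gen (Tensor x y) - free_gen (Tensor x' y) | x x' y. True} \<union>
    {free_gen (Tensor x (y + y')) - free_gen (Tensor x y) - free_gen (Tensor x y') | x y y'. True} \<union>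
    {free_gen (Tensor (c *\<^sub>C x) y) - free_const c * free_gen (Tensor x y) | c x y. True} \<union>
    {free_gen (Tensor x (c *\<^sub>C y)) - free_const c * free_gen (Tensor x y) | c x y. True} \<union>
    {free_gen (Tensor (x * x') (y * y')) - free_gen (Tensor x y) * free_gen (Tensor x' y')
      | x x' y y'. True} \<union>
    {free_gen (Tensor 1 1) - 1}"
instance ..
end

type_synonym ('a, 'b) tensor = "('a, 'b) tensor_symbol presented" (infixr \<open>\<otimes>\<close> 70)

definition tensor :: "'a::complex_algebra_1 \<Rightarrow> 'b::complex_algebra_1 \<Rightarrow> 'a \<otimes> 'b" (infixr \<open>\<otimes>\<close> 70)
  where "x \<otimes> y = gen (Tensor x y)"

text \<open>\<open>x \<otimes> y \<mapsto> f x * g y\<close>, for algebra homomorphisms \<open>f\<close>, \<open>g\<close> with commuting images.\<close>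

definition tensor_mult_map ::
  "('a::complex_algebra_1 \<Rightarrow> 'c::complex_algebra_1) \<Rightarrow> ('b::complex_algebra_1 \<Rightarrow> 'c) \<Rightarrow> 'a \<otimes> 'b \<Rightarrow> 'c" where
  "tensor_mult_map f g = extend (\<lambda>s. case s of Tensor x y \<Rightarrow> f x * g y)"

definition tensor_map ::
  "('a::complex_algebra_1 \<Rightarrow> 'c::complex_algebra_1) \<Rightarrow> ('b::complex_algebra_1 \<Rightarrow> 'd::complex_algebra_1) \<Rightarrow>
    'a \<otimes> 'b \<Rightarrow> 'c \<otimes> 'd" where
  "tensor_map f g = tensor_mult_map (\<lambda>x. f x \<otimes> 1) (\<lambda>y. 1 \<otimes> g y)"

section \<open>The Lie algebra \<open>gl\<^sub>n\<close>, its enveloping algebra and its representations\<close>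

type_synonym 'n gl = "complex^'n^'n"

definition matrix_unit :: "'n::finite \<Rightarrow> 'n \<Rightarrow> 'n gl" where
  "matrix_unit i j = (\<chi> a b. if a = i \<and> b = j then 1 else 0)"

datatype 'n gl_gen = Gl "'n gl"

instantiation gl_gen :: (finite) presentation
begin
definition relators_gl_gen :: "'a gl_gen free_alg set" where
  "relators_gl_gen =
    {free_gen (Gl (x + y)) - free_gen (Gl x) - free_gen (Gl y) | x y. True} \<union>
    {free_gen (Gl (c *\<^sub>C x)) - free_const c * free_gen (Gl x) | c x. True} \<union>
    {free_gen (Gl (x ** y - y ** x)) -
      (free_gen (Gl x) * free_gen (Gl y) - free_gen (Gl y) * free_gen (Gl x)) | x y. True}"
instance ..
end

type_synonym 'n U_gl = "'n gl_gen presented"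

definition gl_representation :: "('n::finite gl \<Rightarrow> 'v::complex_vector endo) \<Rightarrow> bool" where
  "gl_representation \<pi> \<longleftrightarrow> Vector_Spaces.linear scaleC scaleC \<pi> \<and>
    (\<forall>x y. \<pi> (x ** y - y ** x) = \<pi> x * \<pi> y - \<pi> y * \<pi> x)"

definition irreducible_representation :: "('n::finite gl \<Rightarrow> 'v::complex_vector endo) \<Rightarrow> bool" where
  "irreducible_representation \<pi> \<longleftrightarrow> gl_representation \<pi> \<and> (\<exists>v::'v. v \<noteq> 0) \<and>
    (\<forall>W. complex_vector.subspace W \<and> (\<forall>x. \<forall>w\<in>W. endo_apply (\<pi> x) w \<in> W) \<longrightarrow> W = {0} \<or> W = UNIV)"

definition highest_weight ::
  "('n::{finite,linorder} gl \<Rightarrow> 'v::complex_vector endo) \<Rightarrow> ('n \<Rightarrow> complex) \<Rightarrow> bool" where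
  "highest_weight \<pi> wt \<longleftrightarrow> (\<exists>v. v \<noteq> 0 \<and>
    (\<forall>i j. i < j \<longrightarrow> endo_apply (\<pi> (matrix_unit i j)) v = 0) \<and>
    (\<forall>i. endo_apply (\<pi> (matrix_unit i i)) v = wt i *\<^sub>C v))"

definition U_rep :: "('n gl \<Rightarrow> 'v::complex_vector endo) \<Rightarrow> 'n::finite U_gl \<Rightarrow> 'v endo" where
  "U_rep \<pi> = extend (\<lambda>s. case s of Gl x \<Rightarrow> \<pi> x)"

definition vector_rep :: "'n::finite gl \<Rightarrow> (complex^'n) endo" where
  "vector_rep x = Abs_endo (\<lambda>v. x *v v)"

definition braided_casimir ::
  "('n gl \<Rightarrow> 'v::complex_vector endo) \<Rightarrow> (complex^'n) endo \<otimes> 'v endo" where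
  "braided_casimir \<pi> = (\<Sum>i\<in>UNIV. \<Sum>j\<in>UNIV. vector_rep (matrix_unit i j) \<otimes> \<pi> (matrix_unit j i))"

section \<open>Formal series\<close>

definition map_fps :: "('a \<Rightarrow> 'b) \<Rightarrow> 'a fps \<Rightarrow> 'b fps" where
  "map_fps h F = Abs_fps (\<lambda>k. h (fps_nth F k))"

text \<open>A series in \<open>u\<^sup>-\<^sup>1\<close> is an element of \<^typ>\<open>'a fps\<close> whose indeterminate \<^const>\<open>fps_X\<close> is
  \<open>u\<^sup>-\<^sup>1\<close>. It is (the expansion at infinity of) a rational function of \<open>u\<close> iff it is a quotient
  of polynomials in \<open>u\<^sup>-\<^sup>1\<close>, because \<open>\<complex>(u) = \<complex>(u\<^sup>-\<^sup>1)\<close>.\<close>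

definition rational_series :: "complex fps \<Rightarrow> bool" where
  "rational_series f \<longleftrightarrow> (\<exists>p q. q \<noteq> 0 \<and> f * fps_of_poly q = fps_of_poly p)"

definition scalar_series :: "complex fps \<Rightarrow> 'a::complex_algebra_1 fps" where
  "scalar_series f = map_fps (\<lambda>c. c *\<^sub>C 1) f"

text \<open>Series in two spectral parameters \<open>u\<close>, \<open>v\<close> are series in \<open>u\<^sup>-\<^sup>1\<close> whose coefficients are Laurent
  series in \<open>v\<^sup>-\<^sup>1\<close>, with \<open>\<bar>u\<bar> > \<bar>v\<bar>\<close>: the operations below send \<open>F\<close> to \<open>F(u)\<close>, \<open>F(v)\<close> and \<open>F(u - v)\<close>,
  where \<open>(u - v)\<^sup>-\<^sup>k = (\<Sum>m. ((k + m - 1) choose m) v\<^sup>m u\<^sup>-\<^sup>k\<^sup>-\<^sup>m)\<close> for \<open>k \<ge> 1\<close>.\<close>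

definition at_fst :: "'a::zero fps \<Rightarrow> 'a fls fps" where
  "at_fst F = map_fps fls_const F"

definition at_snd :: "'a::zero fps \<Rightarrow> 'a fls fps" where
  "at_snd F = fps_const (fps_to_fls F)"

definition at_diff :: "'a::complex_vector fps \<Rightarrow> 'a fls fps" where
  "at_diff F = Abs_fps (\<lambda>N. if N = 0 then fls_const (fps_nth F 0)
    else \<Sum>k=1..N. fls_shift (int (N - k))
      (fls_const (of_nat ((N - 1) choose (N - k)) *\<^sub>C fps_nth F k)))"

section \<open>The Yangian\<close>

text \<open>\<open>T_gen i j r\<close> is the generator \<open>t\<^sub>i\<^sub>j\<^sup>(\<^sup>r\<^sup>+\<^sup>1\<^sup>)\<close>.\<close>

datatype 'n yangian_gen = T_gen 'n 'n nat

definition generating_series ::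
  "('n yangian_gen \<Rightarrow> 'a::{zero,one}) \<Rightarrow> 'n \<Rightarrow> 'n \<Rightarrow> 'a fps" where
  "generating_series g i j =
    Abs_fps (\<lambda>r. case r of 0 \<Rightarrow> if i = j then 1 else 0 | Suc s \<Rightarrow> g (T_gen i j s))"

text \<open>Matrices indexed by pairs are operators on \<open>\<complex>\<^sup>n \<otimes> \<complex>\<^sup>n\<close> with coefficients in an algebra of series
  in \<open>u\<^sup>-\<^sup>1\<close> and \<open>v\<^sup>-\<^sup>1\<close>; here \<^term>\<open>fps_X\<close> is \<open>u\<^sup>-\<^sup>1\<close> and \<^term>\<open>fps_const fps_X\<close> is \<open>v\<^sup>-\<^sup>1\<close>.\<close>

definition first_leg :: "('n::finite \<Rightarrow> 'n \<Rightarrow> 'a::zero) \<Rightarrow> 'a^('n \<times> 'n)^('n \<times> 'n)" where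
  "first_leg M = (\<chi> p q. if snd p = snd q then M (fst p) (fst q) else 0)"

definition second_leg :: "('n::finite \<Rightarrow> 'n \<Rightarrow> 'a::zero) \<Rightarrow> 'a^('n \<times> 'n)^('n \<times> 'n)" where
  "second_leg M = (\<chi> p q. if fst p = fst q then M (snd p) (snd q) else 0)"

definition flip_matrix :: "'a::{zero,one}^('n::finite \<times> 'n)^('n \<times> 'n)" where
  "flip_matrix = (\<chi> p q. if p = prod.swap q then 1 else 0)"

text \<open>The Yang matrix \<open>R(u - v) = 1 - P / (u - v)\<close> multiplied by the invertible central element
  \<open>v\<^sup>-\<^sup>1 - u\<^sup>-\<^sup>1 = (u - v) u\<^sup>-\<^sup>1 v\<^sup>-\<^sup>1\<close>, which turns the defining relation
  \<open>R(u - v) T\<^sub>1(u) T\<^sub>2(v) = T\<^sub>2(v) T\<^sub>1(u) R(u - v)\<close> into an identity of power series in \<open>u\<^sup>-\<^sup>1\<close>, \<open>v\<^sup>-\<^sup>1\<close>.\<close>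

definition cleared_yang_matrix :: "'a::ring_1 fps fps^('n::finite \<times> 'n)^('n \<times> 'n)" where
  "cleared_yang_matrix =
    mat (fps_const fps_X - fps_X) - mat (fps_X * fps_const fps_X) ** flip_matrix"

instantiation yangian_gen :: (finite) presentation
begin
definition relators_yangian_gen :: "'a yangian_gen free_alg set" where
  "relators_yangian_gen =
    (let T1 = first_leg (\<lambda>i j. map_fps fps_const (generating_series free_gen i j));
         T2 = second_leg (\<lambda>i j. fps_const (generating_series free_gen i j));
         D = cleared_yang_matrix ** T1 ** T2 - T2 ** T1 ** cleared_yang_matrix
     in {fps_nth (fps_nth (D $ p $ q) a) b | p q a b. True})"
instance ..
end

type_synonym 'n yangian = "'n yangian_gen presented"

definition t_series :: "'n::finite \<Rightarrow> 'n \<Rightarrow> 'n yangian fps" where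
  "t_series = generating_series gen"

text \<open>The homomorphism with \<open>t\<^sub>i\<^sub>j(u) \<mapsto> \<delta>\<^sub>i\<^sub>j - E\<^sub>j\<^sub>i u\<^sup>-\<^sup>1\<close>.\<close>

definition ev :: "'n::finite yangian \<Rightarrow> 'n U_gl" where
  "ev = extend (\<lambda>s. case s of T_gen i j r \<Rightarrow> if r = 0 then - gen (Gl (matrix_unit j i)) else 0)"

definition yangian_rep ::
  "('n gl \<Rightarrow> 'v::complex_vector endo) \<Rightarrow> 'n::finite yangian \<Rightarrow> 'v endo" where
  "yangian_rep \<pi> = U_rep \<pi> \<circ> ev"

text \<open>The homomorphism with \<open>t\<^sub>i\<^sub>j(u) \<mapsto> (\<Sum>k. t\<^sub>i\<^sub>k(u) \<otimes> t\<^sub>k\<^sub>j(u))\<close>.\<close>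

definition coproduct :: "'n::finite yangian \<Rightarrow> 'n yangian \<otimes> 'n yangian" where
  "coproduct = extend (\<lambda>g. case g of T_gen i j r \<Rightarrow>
    \<Sum>k\<in>UNIV. \<Sum>s\<le>Suc r. fps_nth (t_series i k) s \<otimes> fps_nth (t_series k j) (Suc r - s))"

section \<open>The universal R-matrix\<close>

definition leg12 :: "'a::complex_algebra_1 \<otimes> 'a \<Rightarrow> 'a \<otimes> 'a \<otimes> 'a" where
  "leg12 = tensor_map id (\<lambda>y. y \<otimes> 1)"

definition leg13 :: "'a::complex_algebra_1 \<otimes> 'a \<Rightarrow> 'a \<otimes> 'a \<otimes> 'a" where
  "leg13 = tensor_map id (\<lambda>y. 1 \<otimes> y)"

definition leg23 :: "'a::complex_algebra_1 \<otimes> 'a \<Rightarrow> 'a \<otimes> 'a \<otimes> 'a" where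
  "leg23 x = 1 \<otimes> x"

text \<open>\<open>\<Delta> \<otimes> id\<close> followed by the identification \<open>(A \<otimes> A) \<otimes> A = A \<otimes> (A \<otimes> A)\<close>.\<close>

definition coproduct_id :: "'n::finite yangian \<otimes> 'n yangian \<Rightarrow> 'n yangian \<otimes> 'n yangian \<otimes> 'n yangian" where
  "coproduct_id = tensor_mult_map (\<lambda>x. leg12 (coproduct x)) (\<lambda>y. 1 \<otimes> 1 \<otimes> y)"

text \<open>Drinfeld's axioms, in the convention \<open>\<Delta> = \<R> \<Delta>\<^sup>o\<^sup>p \<R>\<^sup>-\<^sup>1\<close> forced by
  \<open>(id \<otimes> \<Delta>) \<R> = \<R>\<^sub>1\<^sub>2 \<R>\<^sub>1\<^sub>3\<close>. The intertwining axiom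
  \<open>\<R>(v) (\<tau>\<^sub>v \<otimes> id)(\<Delta>\<^sup>o\<^sup>p(a)) = (\<tau>\<^sub>v \<otimes> id)(\<Delta>(a)) \<R>(v)\<close>, where \<open>\<tau>\<^sub>v\<close> is the shift
  \<open>t\<^sub>i\<^sub>j(u) \<mapsto> t\<^sub>i\<^sub>j(u - v)\<close>, is imposed on the generators \<open>a = t\<^sub>i\<^sub>j(u)\<close>, and the Yang-Baxter equation
  depends only on the differences of the spectral parameters \<open>u\<close>, \<open>v\<close>, \<open>w\<close>, so \<open>w = 0\<close>.

  The coefficients lie in \<open>Y(n) \<otimes> Y(n)\<close>. The universal R-matrix of the Yangian of \<open>sl\<^sub>n\<close>, with
  coefficients in \<open>Y(sl\<^sub>n) \<otimes> Y(sl\<^sub>n)\<close>, satisfies these axioms, but evaluating its first factor in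
  the vector representation yields \<open>T(u)\<close> only up to a central series. For \<open>Y(n)\<close> the axioms leave
  such a central factor free, and the normalization \<open>T(u) = (\<pi>\<^sub>0 \<otimes> id) \<R>(u)\<close> restricts it.\<close>

definition universal_R_matrix :: "('n::finite yangian \<otimes> 'n yangian) fps \<Rightarrow> bool" where
  "universal_R_matrix \<R> \<longleftrightarrow>
    fps_nth \<R> 0 = 1 \<and>
    map_fps (tensor_map id coproduct) \<R> = map_fps leg12 \<R> * map_fps leg13 \<R> \<and>
    map_fps coproduct_id \<R> = map_fps leg23 \<R> * map_fps leg13 \<R> \<and>
    (\<forall>i j. at_snd \<R> *
        (\<Sum>k\<in>UNIV. at_diff (map_fps (\<lambda>x. x \<otimes> 1) (t_series k j)) *
          at_fst (map_fps (\<lambda>y. 1 \<otimes> y) (t_series i k))) =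
        (\<Sum>k\<in>UNIV. at_diff (map_fps (\<lambda>x. x \<otimes> 1) (t_series i k)) *
          at_fst (map_fps (\<lambda>y. 1 \<otimes> y) (t_series k j))) * at_snd \<R>) \<and>
    at_diff (map_fps leg12 \<R>) * at_fst (map_fps leg13 \<R>) * at_snd (map_fps leg23 \<R>) =
      at_snd (map_fps leg23 \<R>) * at_fst (map_fps leg13 \<R>) * at_diff (map_fps leg12 \<R>)"

definition yang_R_series :: "((complex^'n) endo \<otimes> (complex^'n) endo) fps" where
  "yang_R_series = 1 - fps_const (\<Sum>i\<in>UNIV. \<Sum>j\<in>UNIV.
    vector_rep (matrix_unit i j) \<otimes> vector_rep (matrix_unit j i)) * fps_X"

text \<open>\<open>T(u) = (\<Sum>i j. E\<^sub>i\<^sub>j \<otimes> t\<^sub>i\<^sub>j(u))\<close>, with the matrix factor written first.\<close>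

definition T_matrix_series :: "((complex^'n) endo \<otimes> 'n yangian) fps" where
  "T_matrix_series = Abs_fps (\<lambda>r. \<Sum>i\<in>UNIV. \<Sum>j\<in>UNIV.
    vector_rep (matrix_unit i j) \<otimes> fps_nth (t_series i j) r)"

section \<open>The constructions are well defined\<close>

text \<open>The homomorphisms above are given by \<^const>\<open>extend\<close>; here the relators are checked, and
  \<^const>\<open>vector_rep\<close> is shown to be the irreducible representation of highest weight
  \<open>(1, 0, \<dots>, 0)\<close>.\<close>

lemma alg_homD:
  assumes "alg_hom h"
  shows "h (x + y) = h x + h y" "h (c *\<^sub>C x) = c *\<^sub>C h x" "h (x * y) = h x * h y" "h 1 = 1"
    "h 0 = 0" "h (- x) = - h x" "h (x - y) = h x - h y" "h (sum f A) = (\<Sum>a\<in>A. h (f a))"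
proof -
  show a: "h (x + y) = h x + h y" "h (c *\<^sub>C x) = c *\<^sub>C h x" "h (x * y) = h x * h y" "h 1 = 1" for x y
    using assms by (simp_all add: alg_hom_def clinear_iff)
  show z: "h 0 = 0" using a(1)[of 0 0] by simp
  show m: "h (- x) = - h x" for x
    using a(1)[of x "- x"] z by (simp add: eq_neg_iff_add_eq_0 add.commute)
  show "h (x - y) = h x - h y" using a(1)[of x "- y"] m by simp
  show "h (sum f A) = (\<Sum>a\<in>A. h (f a))"
    by (induction A rule: infinite_finite_induct) (simp_all add: z a)
qed

lemma alg_hom_id: "alg_hom id" "alg_hom (\<lambda>x. x)"
  by (simp_all add: alg_hom_def clinear_iff)

lemma alg_hom_comp: "alg_hom f \<Longrightarrow> alg_hom g \<Longrightarrow> alg_hom (f \<circ> g)"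
  by (simp add: alg_hom_def clinear_iff)

theorem tensor_mult_map_hom:
  assumes f: "alg_hom f" and g: "alg_hom g" and comm: "\<And>x y. f x * g y = g y * f x"
  shows "alg_hom (tensor_mult_map f g)" "tensor_mult_map f g (x \<otimes> y) = f x * g y"
proof -
  have "free_eval (\<lambda>s. case s of Tensor x y \<Rightarrow> f x * g y) r = 0" if "r \<in> relators" for r
  proof -
    have *: "f x * f x' * (g y * g y') = f x * g y * (f x' * g y')" for x x' y y'
      by (metis comm mult.assoc)
    show ?thesis
      using that unfolding relators_tensor_symbol_def
      by (auto simp: free_eval_diff free_eval_gen free_eval_mult free_eval_const free_eval_one
          alg_homD[OF f] alg_homD[OF g] * distrib_left distrib_right scaleC_mult_left scaleC_mult_right)
  qed
  from extend_hom[OF this]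
  show "alg_hom (tensor_mult_map f g)" "tensor_mult_map f g (x \<otimes> y) = f x * g y"
    unfolding tensor_mult_map_def tensor_def by simp_all
qed

lemma gen_relator: "r \<in> relators \<Longrightarrow> free_eval gen r = 0"
proof -
  have 1: "prod_list (map gen xs) = abs_presented (Poly_Mapping.single (Word xs) 1)" for xs :: "'a list"
    by (induction xs) (simp_all add: one_presented.abs_eq times_presented.abs_eq gen.abs_eq
        free_gen_def mult_single plus_word_def flip: single_one, simp add: zero_word_def)
  have 2: "abs_presented (sum F A) = (\<Sum>a\<in>A. abs_presented (F a))" for F :: "'a word \<Rightarrow> 'a free_alg" and A
    by (induction A rule: infinite_finite_induct)
      (simp_all add: zero_presented.abs_eq flip: plus_presented.abs_eq)
  have 3: "free_eval gen p = abs_presented p" for p :: "'a free_alg"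
    by (rule sym, subst free_alg_expand[of p])
      (simp add: 2 free_eval_def 1 scaleC_presented.abs_eq free_const_def mult_single)
  assume "r \<in> relators"
  then have "1 * r * 1 + 0 \<in> two_sided_ideal relators"
    by (intro two_sided_ideal.intros)
  then show ?thesis by (simp add: 3 zero_presented.abs_eq presented.abs_eq_iff)
qed

lemma tensor_bilinear:
  fixes x x' :: "'a::complex_algebra_1" and y y' :: "'b::complex_algebra_1"
  shows "(x + x') \<otimes> y = x \<otimes> y + x' \<otimes> y" "x \<otimes> (y + y') = x \<otimes> y + x \<otimes> y'"
  "(c *\<^sub>C x) \<otimes> y = c *\<^sub>C (x \<otimes> y)" "x \<otimes> (c *\<^sub>C y) = c *\<^sub>C (x \<otimes> y)"
  "(x \<otimes> y) * (x' \<otimes> y') = (x * x') \<otimes> (y * y')" "1 \<otimes> 1 = (1 :: 'a \<otimes> 'b)"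
proof -
  have "free_gen (Tensor (x + x') y) - free_gen (Tensor x y) - free_gen (Tensor x' y) \<in> relators"
    "free_gen (Tensor x (y + y')) - free_gen (Tensor x y) - free_gen (Tensor x y') \<in> relators"
    "free_gen (Tensor (c *\<^sub>C x) y) - free_const c * free_gen (Tensor x y) \<in> relators"
    "free_gen (Tensor x (c *\<^sub>C y)) - free_const c * free_gen (Tensor x y) \<in> relators"
    "free_gen (Tensor (x * x') (y * y')) - free_gen (Tensor x y) * free_gen (Tensor x' y') \<in> relators"
    "free_gen (Tensor 1 1) - 1 \<in> (relators :: ('a, 'b) tensor_symbol free_alg set)"
    unfolding relators_tensor_symbol_def by blast+
  from this[THEN gen_relator] show
    "(x + x') \<otimes> y = x \<otimes> y + x' \<otimes> y" "x \<otimes> (y + y') = x \<otimes> y + x \<otimes> y'"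
    "(c *\<^sub>C x) \<otimes> y = c *\<^sub>C (x \<otimes> y)" "x \<otimes> (c *\<^sub>C y) = c *\<^sub>C (x \<otimes> y)"
    "(x \<otimes> y) * (x' \<otimes> y') = (x * x') \<otimes> (y * y')" "1 \<otimes> 1 = (1 :: 'a \<otimes> 'b)"
    by (simp_all add: free_eval_diff free_eval_gen free_eval_mult free_eval_const free_eval_one
        free_eval_add tensor_def scaleC_mult_left diff_diff_eq)
qed

lemma tensor_one_hom: "alg_hom (\<lambda>x. x \<otimes> 1)" "alg_hom (\<lambda>y. 1 \<otimes> y)"
  by (simp_all add: alg_hom_def clinear_iff tensor_bilinear)

theorem tensor_map_hom:
  assumes "alg_hom f" "alg_hom g"
  shows "alg_hom (tensor_map f g)" "tensor_map f g (x \<otimes> y) = f x \<otimes> g y"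
proof -
  have "alg_hom (\<lambda>x. f x \<otimes> 1)" "alg_hom (\<lambda>y. 1 \<otimes> g y)"
    using alg_hom_comp[OF tensor_one_hom(1) assms(1)] alg_hom_comp[OF tensor_one_hom(2) assms(2)]
    by (simp_all add: comp_def)
  from tensor_mult_map_hom[OF this]
  show "alg_hom (tensor_map f g)" "tensor_map f g (x \<otimes> y) = f x \<otimes> g y"
    unfolding tensor_map_def by (simp_all add: tensor_bilinear)
qed

theorem U_rep_hom:
  assumes "gl_representation \<pi>"
  shows "alg_hom (U_rep \<pi>)" "U_rep \<pi> (gen (Gl x)) = \<pi> x"
proof -
  have "free_eval (\<lambda>s. case s of Gl x \<Rightarrow> \<pi> x) r = 0" if "r \<in> relators" for r
    using that assms unfolding relators_gl_gen_def
    by (auto simp: gl_representation_def clinear_iff free_eval_diff free_eval_gen free_eval_mult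
        free_eval_const scaleC_mult_left)
  from extend_hom[OF this]
  show "alg_hom (U_rep \<pi>)" "U_rep \<pi> (gen (Gl x)) = \<pi> x"
    unfolding U_rep_def by simp_all
qed

lemma endo_apply_vector_rep: "endo_apply (vector_rep x) v = x *v v"
  unfolding vector_rep_def
  by (subst Abs_endo_inverse)
    (simp_all add: clinear_iff matrix_vector_right_distrib vec_eq_iff matrix_vector_mult_def
      scaleC_vec_def scaleC_complex_def sum_distrib_left mult.left_commute distrib_left sum.distrib)

lemma gl_representation_vector_rep: "gl_representation vector_rep"
  unfolding gl_representation_def clinear_iff
proof (intro conjI allI)
  fix x y :: "'a gl" and c
  show "vector_rep (x + y) = vector_rep x + vector_rep y"
    by (simp add: endo_apply_inject[symmetric] plus_endo.rep_eq endo_apply_vector_rep fun_eq_iff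
        matrix_vector_mult_add_rdistrib)
  show "vector_rep (c *\<^sub>C x) = c *\<^sub>C vector_rep x"
    by (simp add: endo_apply_inject[symmetric] scaleC_endo.rep_eq endo_apply_vector_rep fun_eq_iff
        matrix_vector_mult_def scaleC_vec_def scaleC_complex_def vec_eq_iff sum_distrib_left mult.assoc)
  show "vector_rep (x ** y - y ** x) = vector_rep x * vector_rep y - vector_rep y * vector_rep x"
    by (simp add: endo_apply_inject[symmetric] minus_endo.rep_eq times_endo.rep_eq
        endo_apply_vector_rep fun_eq_iff matrix_vector_mult_diff_rdistrib matrix_vector_mul_assoc)
qed

lemma matrix_unit_vector: "matrix_unit i j *v v = axis i (v $ j)"
  by (simp add: matrix_unit_def matrix_vector_mult_def vec_eq_iff axis_def if_distribR if_distrib[of "\<lambda>x. x * _"]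
      cong: if_cong)
   

theorem vector_rep_highest_weight:
  fixes \<pi> :: "'n::{finite,linorder} gl \<Rightarrow> (complex, 'n) vec endo"
  defines "\<pi> \<equiv> vector_rep"
  shows "irreducible_representation \<pi>"
    and "highest_weight \<pi> (\<lambda>i. of_nat (if i = Min UNIV then 1 else 0))"
proof -
  let ?v = "axis (Min UNIV) 1 :: (complex, 'n) vec"
  have v: "?v \<noteq> 0" by (simp add: axis_eq_0_iff)
  show "highest_weight \<pi> (\<lambda>i. of_nat (if i = Min UNIV then 1 else 0))"
    unfolding highest_weight_def
  proof (intro exI[of _ ?v] conjI allI impI v)
    fix i j :: 'n assume "i < j"
    then have "j \<noteq> Min UNIV" by (metis Min_le UNIV_I finite leD)
    then show "endo_apply (\<pi> (matrix_unit i j)) ?v = 0"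
      by (simp add: \<pi>_def endo_apply_vector_rep matrix_unit_vector axis_def vec_eq_iff)
  next
    fix i :: 'n
    show "endo_apply (\<pi> (matrix_unit i i)) ?v = of_nat (if i = Min UNIV then 1 else 0) *\<^sub>C ?v"
      by (simp add: \<pi>_def endo_apply_vector_rep matrix_unit_vector axis_def vec_eq_iff
          scaleC_vec_def scaleC_complex_def)
  qed
  show "irreducible_representation \<pi>"
    unfolding irreducible_representation_def
  proof (intro conjI allI impI)
    show "gl_representation \<pi>" by (simp add: \<pi>_def gl_representation_vector_rep)
    show "\<exists>v::(complex, 'n) vec. v \<noteq> 0" using v by blast
    fix W :: "(complex, 'n) vec set"
    assume W: "complex_vector.subspace W \<and> (\<forall>x. \<forall>w\<in>W. endo_apply (\<pi> x) w \<in> W)"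
    show "W = {0} \<or> W = UNIV"
    proof (cases "W \<subseteq> {0}")
      case True
      then show ?thesis using complex_vector.subspace_0[of W] W by blast
    next
      case False
      then obtain w where "w \<in> W" "w \<noteq> 0" by blast
      then obtain j where w: "w \<in> W" "w $ j \<noteq> 0" by (auto simp: vec_eq_iff)
      have ax: "axis i c \<in> W" for i c
      proof -
        have "axis i (w $ j) \<in> W"
          using W w(1) by (metis \<pi>_def endo_apply_vector_rep matrix_unit_vector)
        then have "(c / w $ j) *\<^sub>C axis i (w $ j) \<in> W"
          using W complex_vector.subspace_scale by blast
        moreover have "(c / w $ j) *\<^sub>C axis i (w $ j) = axis i c"
          using w(2) by (simp add: vec_eq_iff axis_def scaleC_vec_def scaleC_complex_def)
        ultimately show ?thesis by simp
      qed
      have "x \<in> W" for x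
      proof -
        have "x = (\<Sum>i\<in>UNIV. axis i (x $ i))"
          by (simp add: vec_eq_iff axis_def)
        also have "\<dots> \<in> W" using W ax by (intro complex_vector.subspace_sum) auto
        finally show ?thesis .
      qed
      then show ?thesis by blast
    qed
  qed
qed


lemma mat_mult_entry:
  fixes M :: "'a::ring_1^('n::finite \<times> 'n)^('n \<times> 'n)"
  shows "(mat c ** M) $ p $ q = c * M $ p $ q" "(M ** mat c) $ p $ q = M $ p $ q * c"
    "(flip_matrix ** M) $ p $ q = M $ prod.swap p $ q"
    "(M ** flip_matrix) $ p $ q = M $ p $ prod.swap q"
proof -
  show "(mat c ** M) $ p $ q = c * M $ p $ q" "(M ** mat c) $ p $ q = M $ p $ q * c"
    by (simp_all add: matrix_matrix_mult_def mat_def if_distrib if_distribR cong: if_cong)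
  have "p = prod.swap r \<longleftrightarrow> r = prod.swap p" for r :: "'n \<times> 'n"
    by (cases p; cases r) auto
  then show "(flip_matrix ** M) $ p $ q = M $ prod.swap p $ q"
    "(M ** flip_matrix) $ p $ q = M $ p $ prod.swap q"
    by (simp_all add: matrix_matrix_mult_def flip_matrix_def if_distrib if_distribR cong: if_cong)
qed

lemma leg_mult_entry:
  fixes M N :: "'n::finite \<Rightarrow> 'n \<Rightarrow> 'a::ring_1"
  shows "(first_leg M ** second_leg N) $ (i, k) $ (j, l) = M i j * N k l"
    "(second_leg N ** first_leg M) $ (i, k) $ (j, l) = N k l * M i j"
proof -
  have "(first_leg M ** second_leg N) $ (i, k) $ (j, l) =
      (\<Sum>r\<in>UNIV. if r = (j, k) then M i j * N k l else 0)"
    unfolding matrix_matrix_mult_def first_leg_def second_leg_def vec_lambda_beta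
    by (rule sum.cong) auto
  then show "(first_leg M ** second_leg N) $ (i, k) $ (j, l) = M i j * N k l" by simp
  have "(second_leg N ** first_leg M) $ (i, k) $ (j, l) =
      (\<Sum>r\<in>UNIV. if r = (i, l) then N k l * M i j else 0)"
    unfolding matrix_matrix_mult_def first_leg_def second_leg_def vec_lambda_beta
    by (rule sum.cong) auto
  then show "(second_leg N ** first_leg M) $ (i, k) $ (j, l) = N k l * M i j" by simp
qed

lemma cleared_yang_matrix_entry:
  fixes M N :: "'n::finite \<Rightarrow> 'n \<Rightarrow> 'a::ring_1 fps fps"
  defines "c \<equiv> fps_const fps_X - fps_X :: 'a fps fps" and "d \<equiv> fps_X * fps_const fps_X :: 'a fps fps"
  shows "(cleared_yang_matrix ** first_leg M ** second_leg N -
      second_leg N ** first_leg M ** cleared_yang_matrix) $ (i, k) $ (j, l) =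
    c * (M i j * N k l) - d * (M k j * N i l) - ((N k l * M i j) * c - (N k j * M i l) * d)"
proof -
  have diff: "(A - B) ** C = A ** C - B ** C" "C ** (A - B) = C ** A - C ** B"
    for A B C :: "'a fps fps^('n \<times> 'n)^('n \<times> 'n)"
    by (simp_all add: matrix_matrix_mult_def vec_eq_iff algebra_simps sum_subtractf)
  have 1: "cleared_yang_matrix ** first_leg M ** second_leg N =
      mat c ** (first_leg M ** second_leg N) - mat d ** (flip_matrix ** (first_leg M ** second_leg N))"
    unfolding cleared_yang_matrix_def c_def d_def by (simp add: diff matrix_mul_assoc)
  have comm: "mat d ** flip_matrix = flip_matrix ** (mat d :: 'a fps fps^('n \<times> 'n)^('n \<times> 'n))"
    unfolding vec_eq_iff mat_mult_entry
    by (auto simp: flip_matrix_def mat_def)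
  have 2: "second_leg N ** first_leg M ** cleared_yang_matrix =
      (second_leg N ** first_leg M) ** mat c - ((second_leg N ** first_leg M) ** flip_matrix) ** mat d"
    unfolding cleared_yang_matrix_def c_def[symmetric] d_def[symmetric] comm
    by (simp add: diff matrix_mul_assoc)
  show ?thesis
    unfolding 1 2 by (simp add: mat_mult_entry leg_mult_entry)
qed

instance fps :: ("{semiring_0, monoid_mult}") monoid_mult
  by standard (simp_all add: fps_eq_iff fps_mult_nth mult_delta_left mult_delta_right fps_one_nth)

lemma fps_X_central: "fps_X * F = F * fps_X" "fps_const fps_X * G = G * fps_const fps_X"
  for F :: "'a::complex_algebra_1 fps" and G :: "'a fps fps"
  by (simp_all add: fps_mult_fps_X_commute fps_eq_iff)

text \<open>The entries of \<open>R(u - v) T\<^sub>1(u) T\<^sub>2(v) = T\<^sub>2(v) T\<^sub>1(u) R(u - v)\<close> for \<open>T(u) = (s\<^sub>i\<^sub>j(u))\<close>.\<close>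

definition yang_relation ::
  "('n \<Rightarrow> 'n \<Rightarrow> 'a::complex_algebra_1 fps) \<Rightarrow> bool" where
  "yang_relation s \<longleftrightarrow> (\<forall>i j k l.
    (let U = map_fps fps_const; V = fps_const; c = fps_const fps_X - fps_X; d = fps_X * fps_const fps_X in
     c * (U (s i j) * V (s k l)) - d * (U (s k j) * V (s i l)) =
     (V (s k l) * U (s i j)) * c - (V (s k j) * U (s i l)) * d))"

lemma map_fps_nth [simp]: "fps_nth (map_fps h F) k = h (fps_nth F k)"
  by (simp add: map_fps_def)

lemma fps_nth_sum: "fps_nth (sum f A) n = (\<Sum>a\<in>A. fps_nth (f a) n)" for f :: "'b \<Rightarrow> 'a::comm_monoid_add fps"
  by (induction A rule: infinite_finite_induct) auto

lemma generating_relators: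
  fixes g :: "'n::finite yangian_gen \<Rightarrow> 'a::complex_algebra_1"
  shows "yang_relation (generating_series g) \<longleftrightarrow> (\<forall>r\<in>relators. free_eval g r = 0)"
proof -
  let ?h = "free_eval g"
  define H where "H = (\<lambda>F :: 'n yangian_gen free_alg fps fps. map_fps (map_fps ?h) F)"
  note h = free_eval_add free_eval_diff free_eval_mult free_eval_zero free_eval_one free_eval_sum
  have h1: "map_fps ?h (F * G) = map_fps ?h F * map_fps ?h G" for F G
    by (simp add: fps_eq_iff fps_mult_nth h)
  have h2: "map_fps ?h (sum F A) = (\<Sum>a\<in>A. map_fps ?h (F a))" for F :: "nat \<Rightarrow> _" and A
    by (simp add: fps_eq_iff fps_nth_sum h)
  have H: "H (F - G) = H F - H G" "H (F * G) = H F * H G" for F G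
    by (simp_all add: H_def fps_eq_iff[of "map_fps _ _"] fps_mult_nth h1 h2) (simp add: fps_eq_iff h)
  have X: "map_fps ?h fps_X = fps_X" "map_fps ?h 0 = 0" "map_fps ?h 1 = 1"
    by (simp_all add: fps_eq_iff fps_X_nth h)
  have HX: "H fps_X = fps_X" "H (fps_const fps_X) = fps_const fps_X"
    unfolding H_def by (auto simp add: fps_eq_iff[of "map_fps _ _"] fps_X_nth X h)
  have gs: "map_fps ?h (generating_series free_gen i j) = generating_series g i j" for i j
    by (auto simp: fps_eq_iff generating_series_def free_eval_gen h split: nat.split)
  have HU: "H (map_fps fps_const (generating_series free_gen i j)) = map_fps fps_const (generating_series g i j)"
    "H (fps_const (generating_series free_gen i j)) = fps_const (generating_series g i j)" for i j
    unfolding gs[symmetric] H_def by (auto simp: fps_eq_iff h)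
  have H0: "H F = 0 \<longleftrightarrow> (\<forall>a b. ?h (fps_nth (fps_nth F a) b) = 0)" for F
    by (simp add: H_def fps_eq_iff)
  define D where "D = (let T1 = first_leg (\<lambda>i j :: 'n. map_fps fps_const (generating_series free_gen i j));
         T2 = second_leg (\<lambda>i j. fps_const (generating_series free_gen i j))
     in cleared_yang_matrix ** T1 ** T2 - T2 ** T1 ** cleared_yang_matrix)"
  have "(\<forall>r\<in>relators. free_eval g r = 0) \<longleftrightarrow> (\<forall>p q. H (D $ p $ q) = 0)"
    unfolding relators_yangian_gen_def H0 D_def Let_def by blast
  also have "\<dots> \<longleftrightarrow> (\<forall>i k j l. H (D $ (i, k) $ (j, l)) = 0)" by (auto simp: split_paired_all)
  also have "\<dots> \<longleftrightarrow> yang_relation (generating_series g)"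
    unfolding D_def Let_def cleared_yang_matrix_entry yang_relation_def
    by (simp add: H HX HU) blast
  finally show ?thesis by blast
qed

theorem extend_yangian_hom:
  assumes "yang_relation (generating_series g)"
  shows "alg_hom (extend g)" "extend g (gen x) = g x"
  using extend_hom[of g] assms generating_relators by blast+

theorem yang_relation_t_series: "yang_relation t_series"
  unfolding t_series_def by (simp add: generating_relators gen_relator)

lemma fps2_eqI: "(\<And>a b. fps_nth (fps_nth F a) b = fps_nth (fps_nth G a) b) \<Longrightarrow> F = G"
  for F G :: "'a fps fps" by (simp add: fps_eq_iff)

lemma yang_factor_nth:
  fixes F :: "'a::complex_algebra_1 fps fps"
  shows "fps_nth (fps_nth ((fps_const fps_X - fps_X) * F) a) b =
      (if b = 0 then 0 else fps_nth (fps_nth F a) (b - 1)) - (if a = 0 then 0 else fps_nth (fps_nth F (a - 1)) b)"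
    "fps_nth (fps_nth (F * (fps_const fps_X - fps_X)) a) b =
      (if b = 0 then 0 else fps_nth (fps_nth F a) (b - 1)) - (if a = 0 then 0 else fps_nth (fps_nth F (a - 1)) b)"
    "fps_nth (fps_nth (fps_X * fps_const fps_X * F) a) b =
      (if a = 0 \<or> b = 0 then 0 else fps_nth (fps_nth F (a - 1)) (b - 1))"
    "fps_nth (fps_nth (F * (fps_X * fps_const fps_X)) a) b =
      (if a = 0 \<or> b = 0 then 0 else fps_nth (fps_nth F (a - 1)) (b - 1))"
  by (simp_all add: left_diff_distrib right_diff_distrib mult.assoc flip: fps_X_central)
    (simp_all add: mult.assoc[symmetric] flip: fps_X_central)

lemma UV_nth:
  fixes p q :: "'a::complex_algebra_1 fps"
  shows "fps_nth (fps_nth (map_fps fps_const p * fps_const q) a) b = fps_nth p a * fps_nth q b"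
    "fps_nth (fps_nth (fps_const q * map_fps fps_const p) a) b = fps_nth q b * fps_nth p a"
  by simp_all

lemma yang_relation_coeffI:
  fixes s :: "'n \<Rightarrow> 'n \<Rightarrow> 'a::complex_algebra_1 fps"
  assumes zero: "\<And>i j. fps_nth (s i j) 0 = (if i = j then 1 else 0)"
    and rel: "\<And>i j k l a b.
      fps_nth (s i j) (Suc a) * fps_nth (s k l) b - fps_nth (s i j) a * fps_nth (s k l) (Suc b) -
        fps_nth (s k j) a * fps_nth (s i l) b =
      fps_nth (s k l) b * fps_nth (s i j) (Suc a) - fps_nth (s k l) (Suc b) * fps_nth (s i j) a -
        fps_nth (s k j) b * fps_nth (s i l) a"
  shows "yang_relation s"
  unfolding yang_relation_def Let_def
proof (intro allI fps2_eqI)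
  fix i j k l a b
  show "fps_nth (fps_nth ((fps_const fps_X - fps_X) * (map_fps fps_const (s i j) * fps_const (s k l)) -
        fps_X * fps_const fps_X * (map_fps fps_const (s k j) * fps_const (s i l))) a) b =
    fps_nth (fps_nth (fps_const (s k l) * map_fps fps_const (s i j) * (fps_const fps_X - fps_X) -
        fps_const (s k j) * map_fps fps_const (s i l) * (fps_X * fps_const fps_X)) a) b"
    unfolding fps_sub_nth yang_factor_nth UV_nth
    by (cases a; cases b) (simp_all add: zero rel)
qed

lemma gen_commutator:
  fixes x y :: "'n::finite gl"
  shows "gen (Gl x) * gen (Gl y) - gen (Gl y) * gen (Gl x) = gen (Gl (x ** y - y ** x))"
  "gen (Gl (x + y)) = gen (Gl x) + gen (Gl y)" "gen (Gl (c *\<^sub>C x)) = c *\<^sub>C gen (Gl x)"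
proof -
  have "free_gen (Gl (x ** y - y ** x)) -
      (free_gen (Gl x) * free_gen (Gl y) - free_gen (Gl y) * free_gen (Gl x)) \<in> relators"
    "free_gen (Gl (x + y)) - free_gen (Gl x) - free_gen (Gl y) \<in> relators"
    "free_gen (Gl (c *\<^sub>C x)) - free_const c * free_gen (Gl x) \<in> relators"
    unfolding relators_gl_gen_def by blast+
  from this[THEN gen_relator] show
    "gen (Gl x) * gen (Gl y) - gen (Gl y) * gen (Gl x) = gen (Gl (x ** y - y ** x))"
    "gen (Gl (x + y)) = gen (Gl x) + gen (Gl y)" "gen (Gl (c *\<^sub>C x)) = c *\<^sub>C gen (Gl x)"
    by (simp_all add: free_eval_diff free_eval_gen free_eval_mult free_eval_const free_eval_add
        scaleC_mult_left diff_diff_eq)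
qed

lemma gen_Gl_hom:
  fixes x y :: "'n::finite gl"
  shows "gen (Gl (0 :: 'n gl)) = 0" "gen (Gl (x - y)) = gen (Gl x) - gen (Gl y)"
proof -
  show "gen (Gl (0 :: 'n gl)) = 0" using gen_commutator(2)[of 0 "0 :: 'n gl"] by simp
  show "gen (Gl (x - y)) = gen (Gl x) - gen (Gl y)"
    using gen_commutator(2)[of "x - y" y] by simp
qed

lemma matrix_unit_mult: "matrix_unit i j ** matrix_unit k l = (if j = k then matrix_unit i l else 0)"
proof -
  have "(\<Sum>c\<in>UNIV. matrix_unit i j $ a $ c * matrix_unit k l $ c $ b) =
      (\<Sum>c\<in>UNIV. if c = j then if j = k \<and> a = i \<and> b = l then 1 else 0 else 0)" for a b
    by (rule sum.cong) (auto simp: matrix_unit_def)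
  then show ?thesis
    by (auto simp: matrix_matrix_mult_def vec_eq_iff) (auto simp: matrix_unit_def)
qed

theorem ev_hom:
  "alg_hom (ev :: 'n::finite yangian \<Rightarrow> _)"
  "ev (gen (T_gen i j r)) = (if r = 0 then - gen (Gl (matrix_unit j (i :: 'n))) else 0)"
proof -
  define g where "g = (\<lambda>s. case s of T_gen i j r \<Rightarrow> if r = 0 then - gen (Gl (matrix_unit j (i::'n))) else 0)"
  let ?E = "\<lambda>i j. gen (Gl (matrix_unit i (j::'n)))"
  have s: "fps_nth (generating_series g i j) r =
      (if r = 0 then if i = j then 1 else 0 else if r = 1 then - ?E j i else 0)" for i j r
    by (auto simp: generating_series_def g_def split: nat.split)
  have comm: "?E a b * ?E c d - ?E c d * ?E a b =
    (if b = c then ?E a d else 0) - (if d = a then ?E c b else 0)" for a b c d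
    by (simp add: gen_commutator(1) matrix_unit_mult gen_Gl_hom)
  have "yang_relation (generating_series g)"
  proof (rule yang_relation_coeffI)
    fix i j k l :: 'n and a b :: nat
    have *: "?E j i * ?E l k = ?E l k * ?E j i + ((if i = l then ?E j k else 0) - (if k = j then ?E l i else 0))"
      using comm[of j i l k] by (simp only: diff_eq_eq add.commute)
    consider "a = 0" "b = 0" | "a = 0" "b = 1" | "a = 1" "b = 0" | "a = 0" "b > 1"
      | "a > 1" "b = 0" | "a > 0" "b > 0"
      by linarith
    then show "fps_nth (generating_series g i j) (Suc a) * fps_nth (generating_series g k l) b -
        fps_nth (generating_series g i j) a * fps_nth (generating_series g k l) (Suc b) -
        fps_nth (generating_series g k j) a * fps_nth (generating_series g i l) b =
      fps_nth (generating_series g k l) b * fps_nth (generating_series g i j) (Suc a) -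
        fps_nth (generating_series g k l) (Suc b) * fps_nth (generating_series g i j) a -
        fps_nth (generating_series g k j) b * fps_nth (generating_series g i l) a"
      unfolding s by cases (simp_all add: *)
  qed (simp add: s)
  from extend_yangian_hom[OF this]
  show "alg_hom (ev :: 'n yangian \<Rightarrow> _)"
    "ev (gen (T_gen i j r)) = (if r = 0 then - gen (Gl (matrix_unit j i)) else 0)"
    unfolding ev_def g_def[symmetric] by (simp_all, simp add: g_def)
qed


lemma presented_hom_eqI:
  assumes f: "alg_hom f" and g: "alg_hom g" and eq: "\<And>x. f (gen x) = g (gen x)"
  shows "f y = g y"
proof -
  have 1: "prod_list (map gen xs) = abs_presented (Poly_Mapping.single (Word xs) 1)" for xs :: "'a list"
    by (induction xs) (simp_all add: one_presented.abs_eq times_presented.abs_eq gen.abs_eq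
        free_gen_def mult_single plus_word_def flip: single_one, simp add: zero_word_def)
  have 2: "abs_presented (sum F A) = (\<Sum>a\<in>A. abs_presented (F a))" for F :: "'a word \<Rightarrow> 'a free_alg" and A
    by (induction A rule: infinite_finite_induct)
      (simp_all add: zero_presented.abs_eq flip: plus_presented.abs_eq)
  have 3: "abs_presented p = free_eval gen p" for p :: "'a free_alg"
    by (subst free_alg_expand[of p])
      (simp add: 2 free_eval_def 1 scaleC_presented.abs_eq free_const_def mult_single)
  have y: "y = free_eval gen (rep_presented y)"
    by (metis 3 Quotient3_abs_rep[OF Quotient3_presented])
  have w: "h (prod_list (map gen xs)) = prod_list (map (\<lambda>x. h (gen x)) xs)" if "alg_hom h" for h xs
    by (induction xs) (simp_all add: alg_homD[OF that])
  show ?thesis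
    by (subst (1 2) y) (simp add: free_eval_def alg_homD[OF f] alg_homD[OF g] w[OF f] w[OF g] eq)
qed

lemma yang_relation_map:
  assumes h: "alg_hom h" and s: "yang_relation s"
  shows "yang_relation (\<lambda>i j. map_fps h (s i j))"
proof -
  define H where "H = (\<lambda>F. map_fps (map_fps h) F)"
  have h1: "map_fps h (F * G) = map_fps h F * map_fps h G" for F G
    by (simp add: fps_eq_iff fps_mult_nth alg_homD[OF h])
  have h2: "map_fps h (sum F A) = (\<Sum>a\<in>A. map_fps h (F a))" for F :: "nat \<Rightarrow> _" and A
    by (simp add: fps_eq_iff fps_nth_sum alg_homD[OF h])
  have H: "H (F - G) = H F - H G" "H (F * G) = H F * H G" for F G
    by (simp_all add: H_def fps_eq_iff[of "map_fps _ _"] fps_mult_nth h1 h2) (simp add: fps_eq_iff alg_homD[OF h])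
  have X: "map_fps h fps_X = fps_X" "map_fps h 0 = 0" "map_fps h 1 = 1"
    by (simp_all add: fps_eq_iff fps_X_nth alg_homD[OF h])
  have HX: "H fps_X = fps_X" "H (fps_const fps_X) = fps_const fps_X"
    unfolding H_def by (auto simp add: fps_eq_iff[of "map_fps _ _"] fps_X_nth X alg_homD[OF h])
  have HU: "H (map_fps fps_const p) = map_fps fps_const (map_fps h p)"
    "H (fps_const p) = fps_const (map_fps h p)" for p
    unfolding H_def by (auto simp: fps_eq_iff alg_homD[OF h])
  show ?thesis
    unfolding yang_relation_def Let_def
  proof (intro allI)
    fix i j k l
    from s have "H ((fps_const fps_X - fps_X) * (map_fps fps_const (s i j) * fps_const (s k l)) -
        fps_X * fps_const fps_X * (map_fps fps_const (s k j) * fps_const (s i l))) =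
      H (fps_const (s k l) * map_fps fps_const (s i j) * (fps_const fps_X - fps_X) -
        fps_const (s k j) * map_fps fps_const (s i l) * (fps_X * fps_const fps_X))"
      unfolding yang_relation_def Let_def by metis
    then show "(fps_const fps_X - fps_X) * (map_fps fps_const (map_fps h (s i j)) * fps_const (map_fps h (s k l))) -
        fps_X * fps_const fps_X * (map_fps fps_const (map_fps h (s k j)) * fps_const (map_fps h (s i l))) =
      fps_const (map_fps h (s k l)) * map_fps fps_const (map_fps h (s i j)) * (fps_const fps_X - fps_X) -
        fps_const (map_fps h (s k j)) * map_fps fps_const (map_fps h (s i l)) * (fps_X * fps_const fps_X)"
      by (simp only: H HX HU X)
  qed
qed

lemma yang_relation_alt:
  fixes s :: "'n \<Rightarrow> 'n \<Rightarrow> 'a::complex_algebra_1 fps"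
  shows "yang_relation s \<longleftrightarrow> (\<forall>i j k l.
    (fps_const fps_X - fps_X) * (map_fps fps_const (s i j) * fps_const (s k l)) =
    (fps_const fps_X - fps_X) * (fps_const (s k l) * map_fps fps_const (s i j)) +
    fps_X * fps_const fps_X * (map_fps fps_const (s k j) * fps_const (s i l) -
      fps_const (s k j) * map_fps fps_const (s i l)))"
proof -
  have cc: "F * (fps_const fps_X - fps_X) = (fps_const fps_X - fps_X) * F"
    and dc: "F * (fps_X * fps_const fps_X) = fps_X * fps_const fps_X * F" for F :: "'a fps fps"
    by (rule fps2_eqI, simp only: yang_factor_nth)+
  have aux: "A - B = C - D \<longleftrightarrow> A = C + (B - D)" for A B C D :: "'a fps fps"
    by (auto simp: algebra_simps)
  show ?thesis
    unfolding yang_relation_def Let_def cc dc aux right_diff_distrib[of "fps_X * fps_const fps_X"] ..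
qed

lemma yang_relation_mult:
  fixes s t :: "'n::finite \<Rightarrow> 'n \<Rightarrow> 'a::complex_algebra_1 fps"
  assumes s: "yang_relation s" and t: "yang_relation t"
    and comm: "\<And>i j k l a b. fps_nth (s i j) a * fps_nth (t k l) b = fps_nth (t k l) b * fps_nth (s i j) a"
  shows "yang_relation (\<lambda>i j. \<Sum>k\<in>UNIV. s i k * t k j)"
proof -
  define U V :: "'a fps \<Rightarrow> 'a fps fps" where "U = map_fps fps_const" and "V = fps_const"
  define c d :: "'a fps fps" where "c = fps_const fps_X - fps_X" and "d = fps_X * fps_const fps_X"
  have cc: "F * c = c * F" and dc: "F * d = d * F" for F :: "'a fps fps"
    by (rule fps2_eqI, simp only: c_def d_def yang_factor_nth)+
  have dl: "A * (d * B) = d * (A * B)" for A B by (metis dc mult.assoc)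
  have UV: "U (x * y) = U x * U y" "U (x + y) = U x + U y" "V (x * y) = V x * V y" "V (x + y) = V x + V y" "U 0 = 0" "V 0 = 0" for x y
  proof -
    show "U (x * y) = U x * U y"
      by (rule fps2_eqI) (simp add: U_def fps_mult_nth fps_nth_sum)
  qed (simp_all add: U_def V_def fps_eq_iff fps_mult_nth)
  have Us: "U (sum f A) = (\<Sum>a\<in>A. U (f a))" "V (sum f A) = (\<Sum>a\<in>A. V (f a))" for f :: "'n \<Rightarrow> _" and A
    by (induction A rule: infinite_finite_induct) (simp_all add: UV)
  have rel: "c * (U (p i j) * V (p k l)) = c * (V (p k l) * U (p i j)) + d * (U (p k j) * V (p i l) - V (p k j) * U (p i l))"
    if "yang_relation p" for p :: "'n \<Rightarrow> 'n \<Rightarrow> 'a fps" and i j k l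
    using that unfolding yang_relation_alt U_def V_def c_def d_def by blast
  have swap: "U (t a b) * V (s i j) = V (s i j) * U (t a b)" "V (t a b) * U (s i j) = U (s i j) * V (t a b)" for a b i j
    by (rule fps2_eqI; simp only: U_def V_def UV_nth comm)+
  have swap': "U (t a b) * (V (s i j) * X) = V (s i j) * (U (t a b) * X)"
    "V (t a b) * (U (s i j) * X) = U (s i j) * (V (t a b) * X)" for a b i j X
    by (simp_all only: swap flip: mult.assoc)
  let ?S = "\<lambda>f. \<Sum>a\<in>UNIV. \<Sum>b\<in>UNIV. (f :: 'n \<Rightarrow> 'n \<Rightarrow> 'a fps fps) a b"
  let ?T = "\<lambda>i j. \<Sum>k\<in>UNIV. s i k * t k j"
  have prodUV: "U (?T i j) * V (?T k l) = ?S (\<lambda>a b. U (s i a) * V (s k b) * (U (t a j) * V (t b l)))" for i j k l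
    unfolding Us UV sum_product by (simp only: mult.assoc swap')
  have prodVU: "V (?T k l) * U (?T i j) = ?S (\<lambda>a b. V (s k b) * U (s i a) * (V (t b l) * U (t a j)))" for i j k l
    unfolding Us UV sum_product
    by (subst sum.swap) (simp only: mult.assoc swap')
  have "c * (U (?T i j) * V (?T k l)) = c * (V (?T k l) * U (?T i j)) + d * (U (?T k j) * V (?T i l) - V (?T k j) * U (?T i l))" for i j k l
  proof -
    have st: "c * (U (s i a) * V (s k b) * (U (t a j) * V (t b l))) =
      c * (V (s k b) * U (s i a) * (V (t b l) * U (t a j))) +
      d * (V (s k b) * U (s i a) * (U (t b j) * V (t a l)) - V (s k b) * U (s i a) * (V (t b j) * U (t a l))) +
      d * (U (s k a) * V (s i b) * (U (t a j) * V (t b l)) - V (s k a) * U (s i b) * (U (t a j) * V (t b l)))" for a b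
    proof -
      have "c * (U (s i a) * V (s k b) * (U (t a j) * V (t b l))) = c * (U (s i a) * V (s k b)) * (U (t a j) * V (t b l))"
        by (simp add: mult.assoc)
      also have "\<dots> = V (s k b) * U (s i a) * (c * (U (t a j) * V (t b l))) +
         d * (U (s k a) * V (s i b) - V (s k a) * U (s i b)) * (U (t a j) * V (t b l))"
        unfolding rel[OF s] by (simp add: distrib_right mult.assoc flip: cc)
      also have "\<dots> = V (s k b) * U (s i a) * (c * (V (t b l) * U (t a j))) + V (s k b) * U (s i a) * (d * (U (t b j) * V (t a l) - V (t b j) * U (t a l))) +
         d * (U (s k a) * V (s i b) - V (s k a) * U (s i b)) * (U (t a j) * V (t b l))"
        unfolding rel[OF t] by (simp add: distrib_left)
      also have "V (s k b) * U (s i a) * (c * (V (t b l) * U (t a j))) = c * (V (s k b) * U (s i a) * (V (t b l) * U (t a j)))"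
        by (metis cc mult.assoc)
      also have "V (s k b) * U (s i a) * (d * (U (t b j) * V (t a l) - V (t b j) * U (t a l))) =
        d * (V (s k b) * U (s i a) * (U (t b j) * V (t a l)) - V (s k b) * U (s i a) * (V (t b j) * U (t a l)))"
        by (simp only: dl right_diff_distrib)
      finally show ?thesis by (simp add: left_diff_distrib right_diff_distrib mult.assoc)
    qed
    have sw: "?S (\<lambda>a b. V (s k b) * U (s i a) * (U (t b j) * V (t a l))) =
      ?S (\<lambda>a b. V (s k a) * U (s i b) * (U (t a j) * V (t b l)))"
      by (rule sum.swap)
    have sw2: "?S (\<lambda>a b. V (s k b) * U (s i a) * (V (t b j) * U (t a l))) = V (?T k j) * U (?T i l)"
      unfolding prodVU by simp
    have "c * (U (?T i j) * V (?T k l)) = ?S (\<lambda>a b. c * (U (s i a) * V (s k b) * (U (t a j) * V (t b l))))"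
      unfolding prodUV by (simp add: sum_distrib_left)
    also have "\<dots> = c * (V (?T k l) * U (?T i j)) +
       d * (?S (\<lambda>a b. V (s k b) * U (s i a) * (U (t b j) * V (t a l))) - V (?T k j) * U (?T i l)) +
       d * (U (?T k j) * V (?T i l) - ?S (\<lambda>a b. V (s k a) * U (s i b) * (U (t a j) * V (t b l))))"
      unfolding st sw2[symmetric]  unfolding prodUV prodVU
      by (simp add: sum.distrib sum_subtractf sum_distrib_left right_diff_distrib)
    finally show ?thesis unfolding sw by (simp add: algebra_simps)
  qed
  then show ?thesis
    unfolding yang_relation_alt U_def V_def c_def d_def by blast
qed

theorem coproduct_hom:
  fixes i j :: "'n::finite"
  shows "alg_hom (coproduct :: 'n yangian \<Rightarrow> _)"
    "map_fps coproduct (t_series i j) =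
      (\<Sum>k\<in>UNIV. map_fps (\<lambda>x. x \<otimes> 1) (t_series i k) * map_fps (\<lambda>y. 1 \<otimes> y) (t_series k j))"
proof -
  define g :: "'n yangian_gen \<Rightarrow> 'n yangian \<otimes> 'n yangian" where "g = (\<lambda>g. case g of T_gen i j r \<Rightarrow>
    \<Sum>k\<in>UNIV. \<Sum>s\<le>Suc r. fps_nth (t_series i k) s \<otimes> fps_nth (t_series k j) (Suc r - s))"
  have t0: "fps_nth (t_series i j) 0 = (if i = j then 1 else 0)" for i j :: 'n
    by (simp add: t_series_def generating_series_def)
  let ?P = "\<lambda>i j. (\<Sum>k\<in>UNIV. map_fps (\<lambda>x. x \<otimes> 1) (t_series i k) * map_fps (\<lambda>y. 1 \<otimes> y) (t_series k j)) :: ('n yangian \<otimes> 'n yangian) fps"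
  note hl = alg_homD[OF tensor_one_hom(1)] and hr = alg_homD[OF tensor_one_hom(2)]
  have gs: "generating_series g i j = ?P i j" for i j
    unfolding fps_eq_iff
  proof
    fix r
    show "fps_nth (generating_series g i j) r = fps_nth (?P i j) r"
    proof (cases r)
      case 0
      have "fps_nth (?P i j) 0 = (\<Sum>k\<in>UNIV. if i = k then if k = j then 1 else 0 else 0)"
        unfolding fps_nth_sum fps_mult_nth_0 map_fps_nth t0
        by (rule sum.cong) (simp_all add: hl hr)
      then show ?thesis using 0 by (simp add: generating_series_def)
    next
      case (Suc m)
      then show ?thesis
        by (simp add: generating_series_def g_def fps_nth_sum fps_mult_nth tensor_bilinear atLeast0AtMost)
    qed
  qed
  have "yang_relation (generating_series g)"
    unfolding gs
    by (intro yang_relation_mult yang_relation_map tensor_one_hom yang_relation_t_series)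
      (simp add: tensor_bilinear)
  from extend_yangian_hom[OF this]
  have h: "alg_hom (coproduct :: 'n yangian \<Rightarrow> _)" and e: "coproduct (gen x) = g x" for x :: "'n yangian_gen"
    unfolding coproduct_def g_def[symmetric] by simp_all
  show "alg_hom (coproduct :: 'n yangian \<Rightarrow> _)" by (rule h)
  have "map_fps coproduct (t_series i j) = generating_series g i j"
    by (auto simp: fps_eq_iff t_series_def generating_series_def e alg_homD[OF h] split: nat.split)
  then show "map_fps coproduct (t_series i j) = ?P i j" by (simp only: gs)
qed

end

theory Submission
  imports Defs
begin

text \<open>Evaluating the first factor of \<open>\<R>(u)\<close> in the vector representation gives
  \<open>T(u) = (\<Sum>i j. E\<^sub>i\<^sub>j \<otimes> t\<^sub>i\<^sub>j(u))\<close>, so it remains to apply the \<open>\<pi>\<close>-evaluation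
  \<open>t\<^sub>i\<^sub>j(u) \<mapsto> \<delta>\<^sub>i\<^sub>j - \<pi>(E\<^sub>j\<^sub>i) u\<^sup>-\<^sup>1\<close> to the second factor. With the normalization of \<open>\<R>(u)\<close> by
  \<open>T(u)\<close>, the scalar factor is \<open>f(u) = 1\<close>.\<close>

text \<open>Both sides are algebra homomorphisms, so it suffices to compare them on the generators
  \<open>x \<otimes> y\<close>. This is what lets the two tensor factors be evaluated one after the
  other.\<close>

lemma tensor_map_comp:
  assumes "alg_hom f" "alg_hom g" "alg_hom f'" "alg_hom g'"
  shows "tensor_map f' g' (tensor_map f g z) = tensor_map (f' \<circ> f) (g' \<circ> g) z"
proof -
  note homs = tensor_map_hom[OF assms(1,2)] tensor_map_hom[OF assms(3,4)]
    tensor_map_hom[OF alg_hom_comp[OF assms(3,1)] alg_hom_comp[OF assms(4,2)]]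
  have "(tensor_map f' g' \<circ> tensor_map f g) z = tensor_map (f' \<circ> f) (g' \<circ> g) z"
  proof (rule presented_hom_eqI[of "tensor_map f' g' \<circ> tensor_map f g"])
    fix s :: "('a, 'c) tensor_symbol"
    obtain x y where "s = Tensor x y" by (cases s)
    then show "(tensor_map f' g' \<circ> tensor_map f g) (gen s) = tensor_map (f' \<circ> f) (g' \<circ> g) (gen s)"
      by (simp add: homs(2,4,6) flip: tensor_def)
  qed (intro alg_hom_comp homs)+
  then show ?thesis by simp
qed

lemma yangian_rep_hom:
  assumes "gl_representation \<pi>"
  shows "alg_hom (yangian_rep \<pi>)"
    and "yangian_rep \<pi> (gen (T_gen i j r)) = (if r = 0 then - \<pi> (matrix_unit j i) else 0)"
  unfolding yangian_rep_def
  using U_rep_hom[OF assms]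
  by (simp_all add: alg_hom_comp ev_hom alg_homD)

text \<open>Generators are indexed from 0, so the one family that evaluation does not kill,
  \<open>T_gen i j 0\<close>, sits at the coefficient of \<open>fps_X\<close>, i.e. of 1/u.\<close>

lemma yangian_rep_t_series:
  assumes "gl_representation \<pi>"
  shows "map_fps (yangian_rep \<pi>) (t_series i j) =
    (if i = j then 1 else 0) - fps_const (\<pi> (matrix_unit j i)) * fps_X"
  by (auto simp: fps_eq_iff t_series_def generating_series_def yangian_rep_hom(2)[OF assms]
      alg_homD[OF yangian_rep_hom(1)[OF assms]] fps_X_nth split: nat.split)

lemma endo_apply_sum: "endo_apply (sum f A) v = (\<Sum>i\<in>A. endo_apply (f i) v)"
  by (induction A rule: infinite_finite_induct) (simp_all add: zero_endo.rep_eq plus_endo.rep_eq)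

lemma sum_vector_rep_matrix_unit_diag: "(\<Sum>i\<in>UNIV. vector_rep (matrix_unit i i)) = 1"
  by (simp add: endo_apply_inject[symmetric] fun_eq_iff endo_apply_sum endo_apply_vector_rep
      one_endo.rep_eq matrix_unit_vector vec_eq_iff axis_def)

lemma tensor_zero_right: "x \<otimes> 0 = 0"
  using tensor_bilinear(2)[of x 0 0] by simp

lemma tensor_uminus_right: "x \<otimes> (- y) = - (x \<otimes> y)"
  using tensor_bilinear(2)[of x "- y" y]
  by (simp add: tensor_zero_right eq_neg_iff_add_eq_0)

text \<open>Evaluation acts entrywise on T(u). Its index transposition, from (i, j) to the matrix
  unit (j, i), is what turns the linear term into the braided Casimir element.\<close>

lemma tensor_map_T_matrix_series:
  assumes "gl_representation \<pi>"
  shows "map_fps (tensor_map id (yangian_rep \<pi>)) T_matrix_series =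
    1 - fps_const (braided_casimir \<pi>) * fps_X"
proof -
  note hom = tensor_map_hom[OF alg_hom_id(1) yangian_rep_hom(1)[OF assms]]
  \<comment> \<open>The constant term of the evaluated T(u): the diagonal matrix units sum to the
    identity.\<close>
  have diag: "(\<Sum>i\<in>UNIV. vector_rep (matrix_unit i i) \<otimes> 1) =
      (1 :: (complex, 'a) vec endo \<otimes> 'b endo)"
    by (simp add: sum_vector_rep_matrix_unit_diag tensor_bilinear(6) flip: alg_homD(8)[OF tensor_one_hom(1)])
  have coeff: "fps_nth (map_fps (tensor_map id (yangian_rep \<pi>)) T_matrix_series) r =
      (\<Sum>i\<in>UNIV. \<Sum>j\<in>UNIV. vector_rep (matrix_unit i j) \<otimes>
        fps_nth ((if i = j then 1 else 0) - fps_const (\<pi> (matrix_unit j i)) * fps_X) r)" for r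
    by (simp add: T_matrix_series_def alg_homD(8)[OF hom(1)] hom(2)
        flip: yangian_rep_t_series[OF assms])
  show ?thesis
    unfolding fps_eq_iff coeff
  proof
    fix r :: nat
    \<comment> \<open>At r = 0 only the diagonal entries survive; at r = 1 the Kronecker delta is
      gone and minus the Casimir sum is left; beyond that every entry vanishes.\<close>
    consider "r = 0" | "r = 1" | "r > 1" by linarith
    then show "(\<Sum>i\<in>UNIV. \<Sum>j\<in>UNIV. vector_rep (matrix_unit i j) \<otimes>
        fps_nth ((if i = j then 1 else 0) - fps_const (\<pi> (matrix_unit j i)) * fps_X) r) =
      fps_nth (1 - fps_const (braided_casimir \<pi>) * fps_X) r"
    proof cases
      case 1
      then show ?thesis
        by (simp add: if_distrib[of "\<lambda>F. fps_nth F _"] if_distrib[of "\<lambda>y. _ \<otimes> y"] tensor_zero_right diag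
            cong: if_cong)
    qed (simp_all add: if_distrib[of "\<lambda>F. fps_nth F _"] tensor_uminus_right tensor_zero_right sum_negf braided_casimir_def
        fps_X_nth cong: if_cong)
  qed
qed

theorem proposition5p1:
  fixes lam :: "'n::{finite,linorder} \<Rightarrow> nat"
    and \<pi> :: "'n gl \<Rightarrow> 'v::complex_vector endo"
    and \<R> :: "('n yangian \<otimes> 'n yangian) fps"
  assumes "antimono lam"
    and "irreducible_representation \<pi>"
    and "highest_weight \<pi> (\<lambda>i. of_nat (lam i))"
    and "universal_R_matrix \<R>"
    and "\<exists>f0. rational_series f0 \<and> yang_R_series = scalar_series f0 *
      map_fps (tensor_map (yangian_rep vector_rep) (yangian_rep vector_rep)) \<R>"
    and "T_matrix_series = map_fps (tensor_map (yangian_rep vector_rep) id) \<R>"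
  shows "\<exists>f. rational_series f \<and>
    map_fps (tensor_map (yangian_rep vector_rep) (yangian_rep \<pi>)) \<R> =
      scalar_series f * (1 - fps_const (braided_casimir \<pi>) * fps_X)"
proof (intro exI[of _ 1] conjI)
  show "rational_series 1"
    unfolding rational_series_def by (intro exI[of _ 1]) simp
  have \<pi>: "gl_representation \<pi>"
    using assms(2) by (simp add: irreducible_representation_def)
  \<comment> \<open>The joint evaluation is split so that the vector representation acts first,
    producing the left factor's T(u).\<close>
  have "map_fps (tensor_map (yangian_rep vector_rep) (yangian_rep \<pi>)) \<R> =
      map_fps (tensor_map id (yangian_rep \<pi>)) (map_fps (tensor_map (yangian_rep vector_rep) id) \<R>)"
    by (simp add: fps_eq_iff tensor_map_comp alg_hom_id(1) yangian_rep_hom(1)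
        gl_representation_vector_rep \<pi>)
  \<comment> \<open>The normalization of \<open>\<R>\<close> identifies the inner series with
    \<open>T_matrix_series\<close>.\<close>
  also have "\<dots> = 1 - fps_const (braided_casimir \<pi>) * fps_X"
    using tensor_map_T_matrix_series[OF \<pi>] by (simp flip: assms(6))
  also have "\<dots> = scalar_series 1 * (1 - fps_const (braided_casimir \<pi>) * fps_X)"
  proof -
    have "scalar_series 1 = (1 :: ((complex, 'n) vec endo \<otimes> 'v endo) fps)"
      by (simp add: fps_eq_iff scalar_series_def scaleC_one)
    then show ?thesis by simp
  qed
  finally show "map_fps (tensor_map (yangian_rep vector_rep) (yangian_rep \<pi>)) \<R> =
      scalar_series 1 * (1 - fps_const (braided_casimir \<pi>) * fps_X)" .
qed

end
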